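(* If $V_1$ and $V_2$ are submodules of the $\mathbb{K}[X]$-module $T_n$ and $V_1\neq V_2$, then the $\mathbb{K}[X]$-modules $V_1$ and $V_2$ are not isomorphic.
   Context: $\mathbb{K}$ is an algebraically closed field of characteristic zero, $n\ge 1$, and $\mathbb{K}[X]:=\mathbb{K}[x_1,\dots,x_n]$ is the polynomial algebra in $n$ variables. $T_n$ denotes the $\mathbb{K}[X]$-module whose underlying vector space is $\mathbb{K}[X]$ and on which the generators act by $x_i\cdot f=\frac{\partial f}{\partial x_i}$, $i=1,\dots,n$, $f\in T_n$. *)

theory Defs
  imports "HOL-Library.Poly_Mapping" "HOL-Computational_Algebra.Polynomial"
begin

text \<open>
  Exponent vectors are finitely supported maps \<open>'n \<Rightarrow>\<^sub>0 nat\<close>, and polynomials are finitely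
  supported maps from exponent vectors to coefficients; their ring structure is the convolution
  product of \<open>HOL-Library.Poly_Mapping\<close>. The variables are indexed by a finite type
  \<open>'n\<close>, so their number is \<open>CARD('n) \<ge> 1\<close>.
\<close>

type_synonym ('n, 'k) mpoly = "('n \<Rightarrow>\<^sub>0 nat) \<Rightarrow>\<^sub>0 'k"

definition mconst :: "'k \<Rightarrow> ('n, 'k::comm_ring_1) mpoly"
  where "mconst c = Poly_Mapping.single 0 c"

definition mvar :: "'n \<Rightarrow> ('n, 'k::comm_ring_1) mpoly"
  where "mvar i = Poly_Mapping.single (Poly_Mapping.single i 1) 1"

text \<open>
  The subtraction of exponent vectors truncates, but only where the coefficient vanishes.
\<close>

definition mpderiv :: "'n \<Rightarrow> ('n, 'k::comm_ring_1) mpoly \<Rightarrow> ('n, 'k) mpoly"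
  where "mpderiv i f = (\<Sum>m\<in>Poly_Mapping.keys f.
    Poly_Mapping.single (m - Poly_Mapping.single i 1)
      (of_nat (Poly_Mapping.lookup m i) * Poly_Mapping.lookup f m))"

text \<open>
  The composite of the operators \<open>mpderiv i ^^ lookup m i\<close> over all variables \<open>i\<close>; the order is
  irrelevant because they commute (\<open>mpderiv_commute\<close>).
\<close>

definition mpderivs :: "('n::finite \<Rightarrow>\<^sub>0 nat) \<Rightarrow> ('n, 'k::comm_ring_1) mpoly \<Rightarrow> ('n, 'k) mpoly"
  where "mpderivs m f = Finite_Set.fold (\<lambda>i. mpderiv i ^^ Poly_Mapping.lookup m i) f UNIV"

text \<open>
  The module \<open>T\<^sub>n\<close>: a polynomial acts on \<open>f\<close> as the differential operator obtained by replacing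
  each variable by the corresponding partial derivative. That this is a module structure is
  \<open>module_T_act\<close>, and it is pinned down by \<open>T_act_mconst\<close> and \<open>T_act_mvar\<close>.
\<close>

definition T_act :: "('n::finite, 'k::comm_ring_1) mpoly \<Rightarrow> ('n, 'k) mpoly \<Rightarrow> ('n, 'k) mpoly"
  where "T_act p f =
    (\<Sum>m\<in>Poly_Mapping.keys p. mconst (Poly_Mapping.lookup p m) * mpderivs m f)"

text \<open>
  Isomorphism of two submodules \<open>V\<close>, \<open>W\<close> of a module with scalar multiplication \<open>s\<close>; the map
  matters only on \<open>V\<close>.
\<close>

definition submodules_isomorphic ::
    "('r::comm_ring_1 \<Rightarrow> 'm::ab_group_add \<Rightarrow> 'm) \<Rightarrow> 'm set \<Rightarrow> 'm set \<Rightarrow> bool"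
  where "submodules_isomorphic s V W \<longleftrightarrow>
    (\<exists>\<phi>. bij_betw \<phi> V W \<and>
         (\<forall>x\<in>V. \<forall>y\<in>V. \<phi> (x + y) = \<phi> x + \<phi> y) \<and>
         (\<forall>r. \<forall>x\<in>V. \<phi> (s r x) = s r (\<phi> x)))"


lemma lookup_mconst_times:
  "Poly_Mapping.lookup (mconst c * f) m = c * Poly_Mapping.lookup f m"
  by (simp add: mconst_def mult_map_scale_conv_mult[symmetric] Poly_Mapping.map.rep_eq when_def)

lemma lookup_mpderiv:
  "Poly_Mapping.lookup (mpderiv i f) m =
    of_nat (Poly_Mapping.lookup m i + 1) * Poly_Mapping.lookup f (m + Poly_Mapping.single i 1)"
proof -
  let ?e = "Poly_Mapping.single i (1::nat)"
  have *: "Poly_Mapping.lookup (Poly_Mapping.single (k - ?e)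
        (of_nat (Poly_Mapping.lookup k i) * Poly_Mapping.lookup f k)) m =
      (if k = m + ?e then of_nat (Poly_Mapping.lookup k i) * Poly_Mapping.lookup f k else 0)" for k
  proof (cases "Poly_Mapping.lookup k i = 0")
    case True
    then show ?thesis by (auto simp: lookup_add)
  next
    case False
    have "k - ?e = m \<longleftrightarrow> k = m + ?e"
    proof
      assume "k - ?e = m"
      moreover have "k = (k - ?e) + ?e"
        using False by (intro poly_mapping_eqI) (auto simp: lookup_add lookup_minus lookup_single when_def)
      ultimately show "k = m + ?e" by simp
    qed simp
    then show ?thesis by (simp add: lookup_single when_def)
  qed
  show ?thesis
    unfolding mpderiv_def lookup_sum *
    by (simp add: sum.delta' in_keys_iff lookup_add)
qed

lemma mpderiv_add: "mpderiv i (f + g) = mpderiv i f + mpderiv i g"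
  by (intro poly_mapping_eqI) (simp add: lookup_mpderiv lookup_add algebra_simps)

lemma mpderiv_mconst_times: "mpderiv i (mconst c * f) = mconst c * mpderiv i f"
  by (intro poly_mapping_eqI) (simp add: lookup_mpderiv lookup_mconst_times mult.left_commute)

lemma mpderiv_commute: "mpderiv i (mpderiv j f) = mpderiv j (mpderiv i f)"
  by (cases "i = j"; intro poly_mapping_eqI)
     (simp_all add: lookup_mpderiv lookup_add lookup_single algebra_simps)

lemma mpderiv_pow_add: "(mpderiv i ^^ a) (f + g) = (mpderiv i ^^ a) f + (mpderiv i ^^ a) g"
  by (induction a) (simp_all add: mpderiv_add)

lemma mpderiv_pow_mconst_times: "(mpderiv i ^^ a) (mconst c * f) = mconst c * (mpderiv i ^^ a) f"
  by (induction a) (simp_all add: mpderiv_mconst_times)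

lemma mpderiv_pow_commute:
  "(mpderiv i ^^ a) ((mpderiv j ^^ b) f) = (mpderiv j ^^ b) ((mpderiv i ^^ a) f)"
proof -
  have "mpderiv i ((mpderiv j ^^ b) f) = (mpderiv j ^^ b) (mpderiv i f)" for f
    by (induction b) (simp_all add: mpderiv_commute[of i j])
  note * = this
  show ?thesis by (induction a) (simp_all add: *)
qed

definition mpderivs_on :: "'n set \<Rightarrow> ('n \<Rightarrow>\<^sub>0 nat) \<Rightarrow> ('n, 'k::comm_ring_1) mpoly \<Rightarrow> ('n, 'k) mpoly"
  where "mpderivs_on A m f = Finite_Set.fold (\<lambda>i. mpderiv i ^^ Poly_Mapping.lookup m i) f A"

lemma mpderivs_conv_on: "mpderivs m f = mpderivs_on UNIV m f"
  by (simp add: mpderivs_def mpderivs_on_def)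

lemma mpderivs_on_empty: "mpderivs_on {} m f = f"
  by (simp add: mpderivs_on_def)

lemma mpderivs_on_insert:
  assumes "finite A" "i \<notin> A"
  shows "mpderivs_on (insert i A) m f = (mpderiv i ^^ Poly_Mapping.lookup m i) (mpderivs_on A m f)"
proof -
  interpret comp_fun_commute "\<lambda>i. mpderiv i ^^ Poly_Mapping.lookup m i"
    by standard (simp add: fun_eq_iff mpderiv_pow_commute)
  show ?thesis using assms by (simp add: mpderivs_on_def)
qed

lemmas mpderivs_on_simps = mpderivs_on_empty mpderivs_on_insert

lemma mpderivs_on_pow:
  "finite A \<Longrightarrow> mpderivs_on A m ((mpderiv j ^^ b) g) = (mpderiv j ^^ b) (mpderivs_on A m g)"
  by (induction A rule: finite_induct)
     (simp_all add: mpderivs_on_simps mpderiv_pow_commute[where j = j and b = b])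

lemma mpderivs_mpderivs: "mpderivs (m + k) f = mpderivs m (mpderivs k f)"
proof -
  have "mpderivs_on A (m + k) f = mpderivs_on A m (mpderivs_on A k f)" if "finite A" for A
    using that
    by (induction A) (simp_all add: mpderivs_on_simps mpderivs_on_pow lookup_add funpow_add
        mpderiv_pow_commute)
  then show ?thesis by (simp add: mpderivs_conv_on)
qed

lemma mpderivs_add: "mpderivs m (f + g) = mpderivs m f + mpderivs m g"
proof -
  have "mpderivs_on A m (f + g) = mpderivs_on A m f + mpderivs_on A m g" if "finite A" for A
    using that by (induction A) (simp_all add: mpderivs_on_simps mpderiv_pow_add)
  then show ?thesis by (simp add: mpderivs_conv_on)
qed

lemma mpderivs_mconst_times: "mpderivs m (mconst c * f) = mconst c * mpderivs m f"
proof -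
  have "mpderivs_on A m (mconst c * f) = mconst c * mpderivs_on A m f" if "finite A" for A
    using that by (induction A) (simp_all add: mpderivs_on_simps mpderiv_pow_mconst_times)
  then show ?thesis by (simp add: mpderivs_conv_on)
qed

lemma mpderivs_0: "mpderivs 0 f = f"
proof -
  have "mpderivs_on A 0 f = f" if "finite A" for A
    using that by (induction A) (simp_all add: mpderivs_on_simps)
  then show ?thesis by (simp add: mpderivs_conv_on)
qed

lemma mpderivs_single: "mpderivs (Poly_Mapping.single i 1) f = mpderiv i f"
proof -
  have "mpderivs_on A (Poly_Mapping.single i 1) f = (if i \<in> A then mpderiv i f else f)"
    if "finite A" for A
    using that by (induction A) (auto simp: mpderivs_on_simps lookup_single when_def)
  then show ?thesis by (simp add: mpderivs_conv_on)
qed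

lemma mconst_0: "mconst 0 = 0"
  by (simp add: mconst_def)

lemma mconst_add: "mconst (a + b) = mconst a + mconst b"
  by (simp add: mconst_def single_add)

lemma mconst_mult: "mconst (a * b) = mconst a * mconst b"
  by (simp add: mconst_def mult_single)

lemma T_act_superset:
  assumes "finite A" "Poly_Mapping.keys p \<subseteq> A"
  shows "T_act p f = (\<Sum>m\<in>A. mconst (Poly_Mapping.lookup p m) * mpderivs m f)"
  unfolding T_act_def
  by (rule sum.mono_neutral_left) (use assms in \<open>auto simp: in_keys_iff mconst_0\<close>)

lemma T_act_add_left: "T_act (p + q) f = T_act p f + T_act q f"
proof -
  let ?A = "Poly_Mapping.keys p \<union> Poly_Mapping.keys q"
  have "Poly_Mapping.keys (p + q) \<subseteq> ?A" by (rule keys_add)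
  then show ?thesis
    by (simp add: T_act_superset[of ?A] lookup_add mconst_add algebra_simps sum.distrib)
qed

lemma T_act_add_right: "T_act p (f + g) = T_act p f + T_act p g"
  by (simp add: T_act_def mpderivs_add algebra_simps sum.distrib)

lemma T_act_0_left: "T_act 0 f = 0"
  by (simp add: T_act_def)

lemma T_act_single: "T_act (Poly_Mapping.single m c) f = mconst c * mpderivs m f"
  by (cases "c = 0") (simp_all add: T_act_def mconst_0)

lemma T_act_mconst: "T_act (mconst c) f = mconst c * f"
  using T_act_single[of 0 c f] by (simp add: mpderivs_0 mconst_def)

lemma T_act_mvar: "T_act (mvar i) f = mpderiv i f"
  by (simp add: mvar_def T_act_single mpderivs_single[simplified]) (simp add: mconst_def)

lemma mpoly_additive_induct [case_names single add]:
  fixes p :: "('n, 'k::comm_ring_1) mpoly"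
  assumes single: "\<And>m c. P (Poly_Mapping.single m c)"
    and add: "\<And>p q. P p \<Longrightarrow> P q \<Longrightarrow> P (p + q)"
  shows "P p"
proof -
  have "P (\<Sum>m\<in>A. Poly_Mapping.single m (Poly_Mapping.lookup p m))" if "finite A" for A
    using that
  proof induction
    case empty
    show ?case using single[of 0 0] by simp
  next
    case (insert m A)
    then show ?case by (simp add: single add)
  qed
  moreover have "(\<Sum>m\<in>Poly_Mapping.keys p. Poly_Mapping.single m (Poly_Mapping.lookup p m)) = p"
    by (intro poly_mapping_eqI) (simp add: lookup_sum lookup_single when_def in_keys_iff)
  ultimately show ?thesis by (metis finite_keys)
qed

lemma T_act_mult:
  fixes p q f :: "('n::finite, 'k::comm_ring_1) mpoly"
  shows "T_act (p * q) f = T_act p (T_act q f)"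
proof -
  have monom: "T_act (Poly_Mapping.single m c * q) f = T_act (Poly_Mapping.single m c) (T_act q f)"
    for m c and q :: "('n, 'k) mpoly"
  proof (induction q rule: mpoly_additive_induct)
    case (single k d)
    show ?case
      by (simp add: mult_single T_act_single mpderivs_mpderivs[symmetric] mpderivs_mconst_times mconst_mult ac_simps)
  next
    case (add q1 q2)
    then show ?case
      by (simp add: distrib_left T_act_add_left T_act_add_right)
  qed
  show ?thesis
  proof (induction p rule: mpoly_additive_induct)
    case (single k d)
    show ?case by (rule monom)
  next
    case (add p1 p2)
    then show ?case by (simp add: distrib_right T_act_add_left)
  qed
qed

lemma module_T_act: "module T_act"
proof
  show "T_act 1 f = f" for f :: "('a, 'b) mpoly"
    using T_act_mconst[of 1 f] by (simp add: mconst_def)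
qed (simp_all add: T_act_add_left T_act_add_right T_act_mult)

interpretation T: module T_act
  by (rule module_T_act)

end

theory Submission
  imports Defs "HOL-Library.FuncSet"
begin

text \<open>
  Rescaling the coefficient of \<open>x\<^sup>m\<close> by \<open>m!\<close> turns differentiation into a shift of exponents
  (\<open>ecoeff_mpderivs\<close>). Consequently the pairing of polynomials
  \<open>\<langle>p, f\<rangle> = (p \<cdot> f)(0)\<close> is perfect in every finite range of exponents: in characteristic zero each
  \<open>m!\<close> is invertible, so every linear functional agrees on such a range with some
  \<open>f \<mapsto> \<langle>p, f\<rangle>\<close> (\<open>functional_represented\<close>), and \<open>f\<close> vanishes if all \<open>\<langle>q, f\<rangle>\<close> do
  (\<open>pairing_nondegenerate\<close>).

  This gives a double annihilator property (\<open>mem_orbit_if_annihilator_subset\<close>): if \<open>p \<cdot> f = 0\<close>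
  always implies \<open>p \<cdot> g = 0\<close>, then \<open>g\<close> lies in the cyclic submodule generated by \<open>f\<close>. Otherwise a
  functional \<open>\<langle>p, -\<rangle>\<close> would vanish on that submodule but not at \<open>g\<close>; as
  \<open>\<langle>q, p \<cdot> f\<rangle> = \<langle>p, q \<cdot> f\<rangle> = 0\<close> for all \<open>q\<close>, this \<open>p\<close> kills \<open>f\<close> without killing \<open>g\<close>.

  An isomorphism \<open>\<phi>\<close> of submodules preserves annihilators, so \<open>f\<close> and \<open>\<phi> f\<close> generate the same
  cyclic submodule. Every submodule is the union of the cyclic submodules of its elements; hence
  source and target of \<open>\<phi>\<close> coincide.
\<close>

section \<open>Differentiation as a shift of exponents\<close>

definition mfact :: "('n::finite \<Rightarrow>\<^sub>0 nat) \<Rightarrow> 'k::field_char_0"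
  where "mfact m = (\<Prod>i\<in>UNIV. fact (Poly_Mapping.lookup m i))"

text \<open>
  The coefficients of a polynomial read as an exponential generating function; equivalently, its
  partial derivatives at the origin.
\<close>

definition ecoeff :: "('n::finite, 'k::field_char_0) mpoly \<Rightarrow> ('n \<Rightarrow>\<^sub>0 nat) \<Rightarrow> 'k"
  where "ecoeff f m = mfact m * Poly_Mapping.lookup f m"

lemma mfact_nonzero: "mfact m \<noteq> 0"
  by (simp add: mfact_def)

lemma mfact_0: "mfact 0 = 1"
  by (simp add: mfact_def)

lemma mfact_add_single:
  "(mfact (m + Poly_Mapping.single i 1) :: 'a::field_char_0) =
    of_nat (Poly_Mapping.lookup m i + 1) * mfact m"
proof -
  have "(fact (Poly_Mapping.lookup (m + Poly_Mapping.single i 1) j) :: 'a) =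
      (if j = i then of_nat (Poly_Mapping.lookup m i + 1) else 1) * fact (Poly_Mapping.lookup m j)"
    for j
    by (simp add: lookup_add lookup_single)
  then show ?thesis
    unfolding mfact_def by (simp add: prod.distrib prod.delta del: One_nat_def)
qed

lemma ecoeff_eq_0_iff: "ecoeff f m = 0 \<longleftrightarrow> Poly_Mapping.lookup f m = 0"
  by (simp add: ecoeff_def mfact_nonzero)

lemma ecoeff_0: "ecoeff f 0 = Poly_Mapping.lookup f 0"
  by (simp add: ecoeff_def mfact_0)

lemma ecoeff_mpderiv: "ecoeff (mpderiv i f) m = ecoeff f (m + Poly_Mapping.single i 1)"
  unfolding ecoeff_def mfact_add_single lookup_mpderiv by (simp only: mult_ac)

lemma ecoeff_mpderiv_pow:
  "ecoeff ((mpderiv i ^^ a) f) m = ecoeff f (m + Poly_Mapping.single i a)"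
proof (induction a arbitrary: m)
  case (Suc a)
  have "Poly_Mapping.single i (Suc a) = Poly_Mapping.single i 1 + Poly_Mapping.single i a"
    by (simp flip: single_add)
  with Suc show ?case
    by (simp add: ecoeff_mpderiv[simplified] add.assoc)
qed simp

text \<open>
  Applying \<open>\<partial>\<^sup>k\<close> shifts the rescaled coefficients without any numerical factor; this replaces all
  bookkeeping of falling factorials in what follows.
\<close>

lemma ecoeff_mpderivs: "ecoeff (mpderivs k f) m = ecoeff f (m + k)"
proof -
  have "ecoeff (mpderivs_on A k f) m =
      ecoeff f (m + (\<Sum>i\<in>A. Poly_Mapping.single i (Poly_Mapping.lookup k i)))"
    if "finite A" for A
    using that
    by (induction A arbitrary: m) (simp_all add: mpderivs_on_simps ecoeff_mpderiv_pow add_ac)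
  moreover have "(\<Sum>i\<in>UNIV. Poly_Mapping.single i (Poly_Mapping.lookup k i)) = k"
    by (intro poly_mapping_eqI) (simp add: lookup_sum lookup_single when_def)
  ultimately show ?thesis
    by (simp add: mpderivs_conv_on)
qed

lemma ecoeff_T_act:
  "ecoeff (T_act p f) m = (\<Sum>k\<in>Poly_Mapping.keys p. Poly_Mapping.lookup p k * ecoeff f (m + k))"
proof -
  have "ecoeff (T_act p f) m =
      (\<Sum>k\<in>Poly_Mapping.keys p. Poly_Mapping.lookup p k * ecoeff (mpderivs k f) m)"
    by (simp add: ecoeff_def T_act_def lookup_sum lookup_mconst_times sum_distrib_left
        mult.left_commute)
  then show ?thesis
    by (simp add: ecoeff_mpderivs)
qed


section \<open>The pairing of polynomials\<close>

lemma pairing_nondegenerate: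
  fixes f :: "('n::finite, 'k::field_char_0) mpoly"
  assumes "\<And>q. Poly_Mapping.lookup (T_act q f) 0 = 0"
  shows "f = 0"
proof (rule poly_mapping_eqI)
  fix m
  have "ecoeff f m = ecoeff (T_act (Poly_Mapping.single m 1) f) 0"
    by (simp add: ecoeff_T_act)
  then have "ecoeff f m = 0"
    using assms by (simp add: ecoeff_0)
  then show "Poly_Mapping.lookup f m = Poly_Mapping.lookup 0 m"
    by (simp add: ecoeff_eq_0_iff)
qed

lemma vector_space_mpoly:
  "vector_space (\<lambda>(c::'k::field) (f::('n::finite, 'k) mpoly). mconst c * f)"
  by standard
    (simp_all add: algebra_simps mconst_add mconst_mult, simp add: mconst_def)

interpretation mp: vector_space_pair
  "\<lambda>(c::'k::field) (f::('n::finite, 'k) mpoly). mconst c * f" "(*) :: 'k \<Rightarrow> 'k \<Rightarrow> 'k"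
  by (intro vector_space_pair.intro vector_space_mpoly) (standard; simp add: algebra_simps)

text \<open>
  The representing polynomial has coefficients \<open>\<psi>(x\<^sup>m) / m!\<close>. Over all exponents it would be a
  power series, which is why \<open>h\<close> has to be confined to a finite range.
\<close>

lemma functional_represented:
  fixes \<psi> :: "('n::finite, 'k::field_char_0) mpoly \<Rightarrow> 'k"
  assumes lin: "Vector_Spaces.linear (\<lambda>c f. mconst c * f) (*) \<psi>"
    and M: "finite M"
  shows "\<exists>p. \<forall>h. Poly_Mapping.keys h \<subseteq> M \<longrightarrow> Poly_Mapping.lookup (T_act p h) 0 = \<psi> h"
proof -
  define p where "p = (\<Sum>m\<in>M. Poly_Mapping.single m (\<psi> (Poly_Mapping.single m 1) / mfact m))"
  have p: "Poly_Mapping.lookup p k = (if k \<in> M then \<psi> (Poly_Mapping.single k 1) / mfact k else 0)"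
    for k
    using M by (simp add: p_def lookup_sum lookup_single when_def)
  have "Poly_Mapping.lookup (T_act p h) 0 = \<psi> h" if h: "Poly_Mapping.keys h \<subseteq> M" for h
  proof -
    have "Poly_Mapping.lookup (T_act p h) 0 =
        (\<Sum>k\<in>Poly_Mapping.keys p. Poly_Mapping.lookup p k * ecoeff h k)"
      by (simp add: ecoeff_T_act flip: ecoeff_0)
    also have "\<dots> = (\<Sum>k\<in>M. Poly_Mapping.lookup p k * ecoeff h k)"
      using M by (intro sum.mono_neutral_left) (auto simp: p in_keys_iff split: if_splits)
    also have "\<dots> = (\<Sum>k\<in>M. Poly_Mapping.lookup h k * \<psi> (Poly_Mapping.single k 1))"
      by (intro sum.cong) (simp_all add: p ecoeff_def mfact_nonzero)
    also have "\<dots> = \<psi> (\<Sum>k\<in>M. mconst (Poly_Mapping.lookup h k) * Poly_Mapping.single k 1)"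
      by (simp add: mp.linear_sum[OF lin] mp.linear_scale[OF lin])
    also have "(\<Sum>k\<in>M. mconst (Poly_Mapping.lookup h k) * Poly_Mapping.single k 1) = h"
      using h M by (intro poly_mapping_eqI)
        (auto simp: lookup_sum lookup_mconst_times lookup_single when_def in_keys_iff
          if_distrib[of "\<lambda>x. _ * x"] cong: if_cong)
    finally show ?thesis .
  qed
  then show ?thesis
    by blast
qed

lemma separating_functional:
  fixes g :: "('n::finite, 'k::field) mpoly"
  assumes W: "mp.vs1.subspace W" and g: "g \<notin> W"
  obtains \<psi> :: "('n, 'k) mpoly \<Rightarrow> 'k"
  where "Vector_Spaces.linear (\<lambda>c f. mconst c * f) (*) \<psi>" "\<And>w. w \<in> W \<Longrightarrow> \<psi> w = 0" "\<psi> g \<noteq> 0"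
proof -
  obtain B where B: "B \<subseteq> W" "mp.vs1.independent B" "W \<subseteq> mp.vs1.span B"
    using mp.vs1.maximal_independent_subset by blast
  have "mp.vs1.span B \<subseteq> W"
    using B(1) W by (rule mp.vs1.span_minimal)
  with g have "g \<notin> mp.vs1.span B"
    by blast
  then have "mp.vs1.independent (insert g B)"
    using B(2) by (rule mp.vs1.independent_insertI)
  from mp.linear_independent_extend[OF this, of "\<lambda>x. if x = g then 1 else 0"]
  obtain \<psi> where \<psi>: "Vector_Spaces.linear (\<lambda>c f. mconst c * f) (*) \<psi>"
    "\<forall>x\<in>insert g B. \<psi> x = (if x = g then 1 else 0)"
    by blast
  have "\<psi> b = 0" if "b \<in> B" for b
    using \<psi>(2) that B(1) g by auto
  then have "\<psi> w = 0" if "w \<in> W" for w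
    using mp.linear_eq_0_on_span[OF \<psi>(1), of B w] B(3) that by blast
  moreover have "\<psi> g \<noteq> 0"
    using \<psi>(2) by simp
  ultimately show thesis
    using \<psi>(1) that by blast
qed


section \<open>The double annihilator property\<close>

lemma finite_exponents_below: "finite {k :: 'n::finite \<Rightarrow>\<^sub>0 nat. \<exists>j. k + j = m}"
proof (rule finite_imageD)
  have "Poly_Mapping.lookup ` {k. \<exists>j. k + j = m} \<subseteq> (\<Pi>\<^sub>E i\<in>UNIV. {..Poly_Mapping.lookup m i})"
    by (auto simp: PiE_def lookup_add)
  then show "finite (Poly_Mapping.lookup ` {k. \<exists>j. k + j = m})"
    by (rule finite_subset) (simp add: finite_PiE)
  show "inj_on Poly_Mapping.lookup {k. \<exists>j. k + j = m}"
    by (simp add: inj_on_def poly_mapping.lookup_inject)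
qed

lemma keys_T_act:
  fixes f :: "('n::finite, 'k::field_char_0) mpoly"
  shows "Poly_Mapping.keys (T_act q f) \<subseteq> (\<Union>m\<in>Poly_Mapping.keys f. {k. \<exists>j. k + j = m})"
proof
  fix k
  assume "k \<in> Poly_Mapping.keys (T_act q f)"
  then have "ecoeff (T_act q f) k \<noteq> 0"
    by (simp add: ecoeff_eq_0_iff in_keys_iff)
  then obtain j where "ecoeff f (k + j) \<noteq> 0"
    unfolding ecoeff_T_act by (metis (lifting) mult_zero_right sum.neutral)
  then show "k \<in> (\<Union>m\<in>Poly_Mapping.keys f. {k. \<exists>j. k + j = m})"
    by (auto simp: ecoeff_eq_0_iff in_keys_iff)
qed

lemma subspace_orbit:
  fixes f :: "('n::finite, 'k::field) mpoly"
  shows "mp.vs1.subspace (range (\<lambda>q. T_act q f))"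
proof (rule mp.vs1.subspaceI)
  show "0 \<in> range (\<lambda>q. T_act q f)"
    by (metis T_act_0_left rangeI)
next
  fix x y
  assume "x \<in> range (\<lambda>q. T_act q f)" "y \<in> range (\<lambda>q. T_act q f)"
  then obtain p q where "x = T_act p f" "y = T_act q f"
    by blast
  then have "x + y = T_act (p + q) f"
    by (simp add: T_act_add_left)
  then show "x + y \<in> range (\<lambda>q. T_act q f)"
    by (rule range_eqI)
next
  fix c x
  assume "x \<in> range (\<lambda>q. T_act q f)"
  then obtain q where "x = T_act q f"
    by blast
  then have "mconst c * x = T_act (mconst c * q) f"
    by (simp only: T_act_mult T_act_mconst)
  then show "mconst c * x \<in> range (\<lambda>q. T_act q f)"
    by (rule range_eqI)
qed

text \<open>
  The hypothesis says that \<open>f \<mapsto> g\<close> extends to a homomorphism of the cyclic module of \<open>f\<close> into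
  \<open>T\<^sub>n\<close>; such a homomorphism thus maps into the cyclic module itself. This is the part of the
  injectivity of \<open>T\<^sub>n\<close> that matters here.
\<close>

lemma mem_orbit_if_annihilator_subset:
  fixes f g :: "('n::finite, 'k::field_char_0) mpoly"
  assumes ann: "\<And>p. T_act p f = 0 \<Longrightarrow> T_act p g = 0"
  shows "\<exists>q. g = T_act q f"
proof (rule ccontr)
  assume "\<nexists>q. g = T_act q f"
  then have "g \<notin> range (\<lambda>q. T_act q f)"
    by blast
  with subspace_orbit obtain \<psi> where
    lin: "Vector_Spaces.linear (\<lambda>c f. mconst c * f) (*) \<psi>"
    and \<psi>_orbit: "\<And>w. w \<in> range (\<lambda>q. T_act q f) \<Longrightarrow> \<psi> w = 0"
    and \<psi>_g: "\<psi> g \<noteq> 0"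
    by (rule separating_functional) blast
  \<comment> \<open>Differentiating \<open>f\<close> only lowers exponents, so one finite range holds its whole orbit.\<close>
  define M where
    "M = (\<Union>m\<in>Poly_Mapping.keys f. {k. \<exists>j. k + j = m}) \<union> Poly_Mapping.keys g"
  have "finite M"
    by (simp add: M_def finite_exponents_below)
  from functional_represented[OF lin this] obtain p where
    p: "\<And>h. Poly_Mapping.keys h \<subseteq> M \<Longrightarrow> Poly_Mapping.lookup (T_act p h) 0 = \<psi> h"
    by blast
  have "T_act p f = 0"
  proof (rule pairing_nondegenerate)
    fix q
    have "Poly_Mapping.keys (T_act q f) \<subseteq> M"
      using keys_T_act[of q f] by (auto simp: M_def)
    then have "Poly_Mapping.lookup (T_act p (T_act q f)) 0 = \<psi> (T_act q f)"
      by (rule p)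
    also have "\<dots> = 0"
      by (rule \<psi>_orbit) (rule rangeI)
    finally have "Poly_Mapping.lookup (T_act p (T_act q f)) 0 = 0" .
    then show "Poly_Mapping.lookup (T_act q (T_act p f)) 0 = 0"
      by (metis T_act_mult mult.commute)
  qed
  then have "T_act p g = 0"
    by (rule ann)
  moreover have "Poly_Mapping.lookup (T_act p g) 0 = \<psi> g"
    by (rule p) (simp add: M_def)
  ultimately show False
    using \<psi>_g by simp
qed


section \<open>Isomorphic submodules are equal\<close>

theorem corollary4:
  fixes V1 V2 :: "('n::finite, 'k::{alg_closed_field, field_char_0}) mpoly set"
  assumes "module.subspace T_act V1"
    and "module.subspace T_act V2"
    and "V1 \<noteq> V2"
  shows "\<not> submodules_isomorphic T_act V1 V2"
proof
  assume "submodules_isomorphic T_act V1 V2"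
  then obtain \<phi> where bij: "bij_betw \<phi> V1 V2"
    and hom: "\<And>r x. x \<in> V1 \<Longrightarrow> \<phi> (T_act r x) = T_act r (\<phi> x)"
    unfolding submodules_isomorphic_def by blast
  have ann: "T_act p (\<phi> x) = 0 \<longleftrightarrow> T_act p x = 0" if x: "x \<in> V1" for p x
  proof -
    have "0 \<in> V1" "T_act p x \<in> V1"
      using assms(1) x by (simp_all add: T.subspace_0 T.subspace_scale)
    moreover have "\<phi> 0 = 0"
      using hom[OF x, of 0] by (simp add: T_act_0_left)
    ultimately show ?thesis
      using hom[OF x, of p] bij by (metis bij_betw_inv_into_left)
  qed
  have "V2 \<subseteq> V1"
  proof
    fix y
    assume "y \<in> V2"
    then obtain x where x: "x \<in> V1" "y = \<phi> x"
      using bij by (auto simp: bij_betw_def)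
    then obtain q where "y = T_act q x"
      using mem_orbit_if_annihilator_subset[of x y] ann by blast
    with x(1) assms(1) show "y \<in> V1"
      by (metis T.subspace_scale)
  qed
  moreover have "V1 \<subseteq> V2"
  proof
    fix x
    assume x: "x \<in> V1"
    then obtain q where "x = T_act q (\<phi> x)"
      using mem_orbit_if_annihilator_subset[of "\<phi> x" x] ann by blast
    moreover have "\<phi> x \<in> V2"
      using bij x by (auto simp: bij_betw_def)
    ultimately show "x \<in> V2"
      using assms(2) by (metis T.subspace_scale)
  qed
  ultimately show False
    using assms(3) by blast
qed

end
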